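(* For all $x\in\mathbb{R}$: a) $Y_x$ is constant (as a function of $(y,z)$). b) $\lim_{\|(y,z)\|\to\infty}Y_x=\tanh\frac x2$. Moreover: c) $\lim_{x\to\pm\infty}Y_x=\pm1$. d) $Y$ (in the coordinates $(x,y,z)$) can be continuously extended to all of $\bar{\mathbb{R}}^3$. e) $Y$ (as a function on $\mathbb{T}$) can be continuously extended to $\overline{\mathbb{T}}$ except for the edges and vertices corresponding to vanishing rows or columns, i.e. to the complement in $\overline{\mathbb{T}}$ of these edges and vertices.
   Context: $\mathbb{T}$ is the set of real $2\times2$ matrices $t=\begin{pmatrix}p_{00}&p_{01}\\ p_{10}&p_{11}\end{pmatrix}$ with all $p_{ij}>0$ and $\sum_{i,j}p_{ij}=1$. $\overline{\mathbb{T}}$ is its closure (all $p_{ij}\ge0$); the edges and vertices corresponding to vanishing rows or columns are the tables in $\overline{\mathbb{T}}$ having a row or a column consisting of zeros. Yule's $Y$ is $Y=\frac{\sqrt\lambda-1}{\sqrt\lambda+1}$ with $\lambda=\frac{p_{00}p_{11}}{p_{01}p_{10}}$ the odds-ratio. Margin transformation coordinates on $\mathbb{T}$ are given by the diffeomorphism $\Psi:\mathbb{R}^3\to\mathbb{T}$, $\Psi(x,y,z)=\frac{1}{e^{x+y+z}+e^x+e^y+e^z}\begin{pmatrix}e^{x+y+z}&e^y\\ e^z&e^x\end{pmatrix}$; for fixed $x$, $Y_x(y,z)=Y(\Psi(x,y,z))$ (the margin weighting function). $\bar{\mathbb{R}}=\mathbb{R}\cup\{-\infty,+\infty\}$ is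 the two-point compactification of $\mathbb{R}$. *)

theory Defs
  imports "HOL-Analysis.Analysis"
begin

(* Rows and columns are indexed by 0 and 1 in the two-element type 2, in which 2 = 0.
   Hence "vector [a, b]" has component b at index 0, and matrices are written out
   entrywise below. *)

definition tables :: "(real^2^2) set" where
  "tables = {t. (\<forall>i j. t $ i $ j > 0) \<and> (\<Sum>i\<in>UNIV. \<Sum>j\<in>UNIV. t $ i $ j) = 1}"

definition degenerate_tables :: "(real^2^2) set" where
  "degenerate_tables = {t \<in> closure tables. (\<exists>i. row i t = 0) \<or> (\<exists>j. column j t = 0)}"

definition odds_ratio :: "real^2^2 \<Rightarrow> real" where
  "odds_ratio t = (t $ 0 $ 0 * t $ 1 $ 1) / (t $ 0 $ 1 * t $ 1 $ 0)"

(* Only meaningful on tables; elsewhere the value is subject to division by zero. *)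
definition Yule_Y :: "real^2^2 \<Rightarrow> real" where
  "Yule_Y t = (sqrt (odds_ratio t) - 1) / (sqrt (odds_ratio t) + 1)"

definition Psi :: "real \<times> real \<times> real \<Rightarrow> real^2^2" where
  "Psi = (\<lambda>(x, y, z).
     (1 / (exp (x + y + z) + exp x + exp y + exp z)) *\<^sub>R
       (\<chi> i j. if i = 0 then (if j = 0 then exp (x + y + z) else exp y)
                        else (if j = 0 then exp z else exp x)))"

definition margin_weighting :: "real \<Rightarrow> real \<times> real \<Rightarrow> real" where
  "margin_weighting x = (\<lambda>(y, z). Yule_Y (Psi (x, y, z)))"

lemma Psi_in_tables: "Psi p \<in> tables"
proof -
  obtain x y z where p: "p = (x, y, z)" by (cases p)
  have UNIV2: "(UNIV :: 2 set) = {0, 1}"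
    using UNIV_2 by auto
  define s where "s = exp (x + y + z) + exp x + exp y + exp z"
  have s: "s > 0" unfolding s_def by (simp add: add_pos_pos)
  then show ?thesis
    unfolding tables_def Psi_def p
    by (simp add: UNIV2 s_def[symmetric] add_divide_distrib[symmetric])
       (simp add: s_def algebra_simps)
qed

end

theory Submission imports Defs "HOL-Real_Asymp.Real_Asymp" begin

text \<open>In margin transformation coordinates the odds ratio is \<open>exp (2 * x)\<close>, so that \<open>Y\<close> equals
  \<open>tanh (x / 2)\<close>; this settles everything except the extension to the closure of the tables. For
  the latter, multiply numerator and denominator of \<open>Y\<close> by \<open>sqrt (p01 * p10)\<close>: the new denominator
  \<open>sqrt (p00 * p11) + sqrt (p01 * p10)\<close> vanishes only if each diagonal contains a zero, that is,
  only if some row or column vanishes.\<close>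

text \<open>The normalizing factor of \<open>Psi\<close> cancels in the quotient, and so do
  \<open>exp y\<close> and \<open>exp z\<close>. The square form lets the root in
  \<open>Yule_Y\<close> simplify to \<open>exp x\<close>.\<close>

lemma odds_ratio_Psi: "odds_ratio (Psi (x, y, z)) = (exp x)\<^sup>2"
proof -
  have "exp (x + y + z) + exp x + exp y + exp z > 0"
    by (simp add: add_pos_pos)
  then have "odds_ratio (Psi (x, y, z)) = (exp (x + y + z) * exp x) / (exp y * exp z)"
    unfolding odds_ratio_def Psi_def by (simp add: divide_simps)
  also have "\<dots> = (exp x)\<^sup>2"
    by (simp add: exp_add power2_eq_square)
  finally show ?thesis .
qed

lemma ratio_minus_one_over_plus_one:
  fixes a b :: "'a :: field"
  assumes "b \<noteq> 0"
  shows "(a / b - 1) / (a / b + 1) = (a - b) / (a + b)"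
proof -
  have "a / b - 1 = (a - b) / b" "a / b + 1 = (a + b) / b"
    using assms by (simp_all add: diff_divide_distrib add_divide_distrib)
  with assms show ?thesis
    by simp
qed

lemma Yule_Y_Psi: "Yule_Y (Psi (x, y, z)) = tanh (x / 2)"
proof -
  \<comment> \<open>As a quotient with denominator \<open>exp (- x)\<close>, this turns
    \<open>Yule_Y\<close> into \<open>(1 - exp (- x)) / (1 + exp (- x))\<close>, the form that
    \<open>tanh_real_altdef\<close> gives for \<open>tanh (x / 2)\<close>.\<close>
  have "exp x = 1 / exp (- x)"
    by (simp add: exp_minus divide_inverse)
  then show ?thesis
    unfolding Yule_Y_def odds_ratio_Psi tanh_real_altdef
    using ratio_minus_one_over_plus_one[of "exp (- x)" 1] by simp
qed

lemma margin_weighting_eq_tanh: "margin_weighting x = (\<lambda>_. tanh (x / 2))"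
  by (auto simp: margin_weighting_def Yule_Y_Psi)

text \<open>The values at the two infinite points are the limits of \<open>tanh (x / 2)\<close>,
  which makes this its continuous extension to the compactified line.\<close>

definition tanh_half_ereal :: "ereal \<Rightarrow> real" where
  "tanh_half_ereal a =
    (if a = \<infinity> then 1 else if a = -\<infinity> then -1 else tanh (real_of_ereal a / 2))"

lemma tanh_half_ereal_simps [simp]:
  "tanh_half_ereal (ereal r) = tanh (r / 2)"
  "tanh_half_ereal \<infinity> = 1"
  "tanh_half_ereal (-\<infinity>) = -1"
  by (simp_all add: tanh_half_ereal_def)

lemma tanh_half_at_top: "((\<lambda>x::real. tanh (x / 2)) \<longlongrightarrow> 1) at_top"
  by (rule filterlim_compose[OF tanh_real_at_top]) real_asymp

lemma tanh_half_at_bot: "((\<lambda>x::real. tanh (x / 2)) \<longlongrightarrow> -1) at_bot"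
  by (rule filterlim_compose[OF tanh_real_at_bot]) real_asymp

text \<open>The punctured neighbourhood filters of \<open>ereal r\<close>,
  \<open>\<infinity>\<close> and \<open>-\<infinity>\<close> are the images under
  \<open>ereal\<close> of \<open>at r\<close>, \<open>at_top\<close> and \<open>at_bot\<close>, so
  each case is a limit of a real function.\<close>

lemma continuous_on_tanh_half_ereal: "continuous_on UNIV tanh_half_ereal"
proof -
  have "(tanh_half_ereal \<longlongrightarrow> tanh_half_ereal a) (at a)" for a
  proof (cases a)
    case (real r)
    have "((\<lambda>x. tanh (x / 2)) \<longlongrightarrow> tanh (r / 2)) (at r)"
      by (intro tendsto_intros) auto
    then show ?thesis
      by (simp add: real at_ereal filterlim_filtermap)
  next
    case PInf
    \<comment> \<open>Since \<open>\<infinity>\<close> is the greatest element, every other point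
      lies to its left.\<close>
    have "at (\<infinity>::ereal) = at_left \<infinity>"
      by (simp add: at_within_def lessThan_def set_diff_eq)
    then show ?thesis
      using tanh_half_at_top by (simp add: PInf at_left_PInf filterlim_filtermap)
  next
    case MInf
    have "at (-\<infinity>::ereal) = at_right (-\<infinity>)"
      by (auto simp: at_within_def intro!: arg_cong2[of _ _ _ _ inf] arg_cong[of _ _ principal])
    then show ?thesis
      using tanh_half_at_bot by (simp add: MInf at_right_MInf filterlim_filtermap)
  qed
  then show ?thesis
    by (simp add: continuous_on_def)
qed

lemma closure_tables_nonneg:
  assumes "t \<in> closure tables"
  shows "t $ i $ j \<ge> 0"
proof -
  have "closed {t :: real^2^2. t $ i $ j \<ge> 0}"
    by (intro closed_Collect_le continuous_intros)
  moreover have "tables \<subseteq> {t. t $ i $ j \<ge> 0}"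
    by (auto simp: tables_def less_imp_le)
  ultimately show ?thesis
    using assms closure_minimal by blast
qed

text \<open>Any entry of one diagonal shares a row or a column with any entry of the other, so a
  zero on each diagonal makes that row or column vanish.\<close>

lemma diagonal_products_nonzero:
  fixes t :: "real^2^2"
  assumes "t \<in> closure tables - degenerate_tables"
  shows "t $ 0 $ 0 * t $ 1 $ 1 \<noteq> 0 \<or> t $ 0 $ 1 * t $ 1 $ 0 \<noteq> 0"
proof (rule ccontr)
  have all2: "(\<forall>i. P i) \<longleftrightarrow> P 0 \<and> P 1" for P :: "2 \<Rightarrow> bool"
  proof -
    have "(UNIV :: 2 set) = {0, 1}"
      using UNIV_2 by auto
    then show ?thesis
      by (metis UNIV_I insertE singletonD)
  qed
  assume "\<not> ?thesis"
  then have "(\<exists>i. \<forall>j. t $ i $ j = 0) \<or> (\<exists>j. \<forall>i. t $ i $ j = 0)"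
    unfolding all2 by auto
  with assms show False
    by (auto simp: degenerate_tables_def row_def column_def vec_eq_iff)
qed

definition Yule_Y_ext :: "real^2^2 \<Rightarrow> real" where
  "Yule_Y_ext t =
    (sqrt (t $ 0 $ 0 * t $ 1 $ 1) - sqrt (t $ 0 $ 1 * t $ 1 $ 0)) /
    (sqrt (t $ 0 $ 0 * t $ 1 $ 1) + sqrt (t $ 0 $ 1 * t $ 1 $ 0))"

lemma continuous_on_Yule_Y_ext: "continuous_on (closure tables - degenerate_tables) Yule_Y_ext"
proof -
  \<comment> \<open>Entries are nonnegative on the closure, hence so are both roots, and their sum
    is zero only if both products are.\<close>
  have "sqrt (t $ 0 $ 0 * t $ 1 $ 1) + sqrt (t $ 0 $ 1 * t $ 1 $ 0) \<noteq> 0"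
    if "t \<in> closure tables - degenerate_tables" for t
    using diagonal_products_nonzero[OF that] closure_tables_nonneg[of t] that
    by (simp add: add_nonneg_eq_0_iff)
  then show ?thesis
    unfolding Yule_Y_ext_def by (intro continuous_intros) auto
qed

lemma Yule_Y_ext_eq:
  assumes "t \<in> tables"
  shows "Yule_Y_ext t = Yule_Y t"
proof -
  define a b where "a = sqrt (t $ 0 $ 0 * t $ 1 $ 1)" and "b = sqrt (t $ 0 $ 1 * t $ 1 $ 0)"
  have "a > 0" "b > 0"
    using assms by (auto simp: a_def b_def tables_def)
  moreover have ratio: "sqrt (odds_ratio t) = a / b"
    by (simp add: odds_ratio_def a_def b_def real_sqrt_divide)
  ultimately show ?thesis
    unfolding Yule_Y_ext_def Yule_Y_def ratio a_def[symmetric] b_def[symmetric]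
    by (simp add: ratio_minus_one_over_plus_one)
qed

theorem proposition9:
  "(\<forall>x. (margin_weighting x constant_on UNIV)
        \<and> (margin_weighting x \<longlongrightarrow> tanh (x / 2)) at_infinity)
   \<and> (\<forall>p. ((\<lambda>x. margin_weighting x p) \<longlongrightarrow> 1) at_top
        \<and> ((\<lambda>x. margin_weighting x p) \<longlongrightarrow> -1) at_bot)
   \<and> (\<exists>F :: ereal \<times> ereal \<times> ereal \<Rightarrow> real.
        continuous_on UNIV F
        \<and> (\<forall>x y z. F (ereal x, ereal y, ereal z) = Yule_Y (Psi (x, y, z))))
   \<and> (\<exists>G :: real^2^2 \<Rightarrow> real.
        continuous_on (closure tables - degenerate_tables) G
        \<and> (\<forall>t\<in>tables. G t = Yule_Y t))"
proof (intro conjI allI)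
  show "margin_weighting x constant_on UNIV" for x
    by (auto simp: margin_weighting_eq_tanh constant_on_def)
  show "(margin_weighting x \<longlongrightarrow> tanh (x / 2)) at_infinity" for x
    by (simp add: margin_weighting_eq_tanh)
  show "((\<lambda>x. margin_weighting x p) \<longlongrightarrow> 1) at_top" for p
    by (simp add: margin_weighting_eq_tanh tanh_half_at_top)
  show "((\<lambda>x. margin_weighting x p) \<longlongrightarrow> -1) at_bot" for p
    by (simp add: margin_weighting_eq_tanh tanh_half_at_bot)
  \<comment> \<open>In these coordinates \<open>Yule_Y\<close> depends on \<open>x\<close> alone, so
    the extension factors through the first projection.\<close>
  have "continuous_on UNIV (tanh_half_ereal \<circ> (fst :: ereal \<times> ereal \<times> ereal \<Rightarrow> ereal))"
    by (intro continuous_on_compose continuous_on_fst continuous_on_id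
        continuous_on_subset[OF continuous_on_tanh_half_ereal]) auto
  then show "\<exists>F :: ereal \<times> ereal \<times> ereal \<Rightarrow> real. continuous_on UNIV F
      \<and> (\<forall>x y z. F (ereal x, ereal y, ereal z) = Yule_Y (Psi (x, y, z)))"
    by (intro exI[of _ "tanh_half_ereal \<circ> fst"]) (simp add: Yule_Y_Psi)
  show "\<exists>G :: real^2^2 \<Rightarrow> real. continuous_on (closure tables - degenerate_tables) G
      \<and> (\<forall>t\<in>tables. G t = Yule_Y t)"
    using continuous_on_Yule_Y_ext Yule_Y_ext_eq by blast
qed

end
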